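(* Two reduced linear trellises $T$ and $T'$ of the same length $n$ are linearly isomorphic if and only if for every span $\mathfrak{s}$ both $$\dim\mathbb{S}_{\mathfrak{s}}(T)=\dim\mathbb{S}_{\mathfrak{s}}(T')\quad\text{and}\quad C_{\mathfrak{s}}(T)=C_{\mathfrak{s}}(T')$$ hold. In particular, two one-to-one reduced linear trellises $T,T'$ of the same length are linearly isomorphic if and only if $C_{\mathfrak{s}}(T)=C_{\mathfrak{s}}(T')$ for all spans $\mathfrak{s}$.
   Context: Let $\mathbb{F}$ be a finite field and $n\ge1$; indices are taken in $\mathbb{Z}_n$. A trellis $T$ of length $n$ over $\mathbb{F}$ consists of pairwise disjoint finite vertex sets $V_i(T)$, $i\in\mathbb{Z}_n$, and edge sets $E_i(T)\subseteq V_i(T)\times\mathbb{F}\times V_{i+1}(T)$; $(v,\alpha,w)\in E_i(T)$ is an edge from $v$ to $w$ with label $\alpha$. Trellises are trim (each vertex has an outgoing and an incoming edge). $T$ is linear if each $V_i(T)$ is an $\mathbb{F}$-vector space and each $E_i(T)$ a subspace of $V_i(T)\times\mathbb{F}\times V_{i+1}(T)$. A cycle is a closed path of length $n$ starting in $V_0(T)$, identified with $(\mathbf{v},\boldsymbol{\alpha})\in\prod_iV_i(T)\times\mathbb{F}^n$; $\mathbb{S}(T)$ is the space of cycles, $L(\mathbf{v},\boldsymbol{\alpha})=\boldsymbol{\alpha}$. $T$ is reduced if every edge lies on a cycle, and one-to-one if $L$ is injective on $\mathbb{S}(T)$. A linear isomorphism $f:T\to T'$ is a family of linear bijections $f_i:V_i(T)\to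 V_i(T')$ with $(v,\alpha,w)\in E_i(T)\iff(f_i(v),\alpha,f_{i+1}(w))\in E_i(T')$. Spans: for $a\in\mathbb{Z}_n$, $0\le l\le n-1$, $[a,a+l]=\{a,\dots,a+l\}\subseteq\mathbb{Z}_n$, $(a,a+l]=[a,a+l]\setminus\{a\}$; the pair $(a,l)$ is a span; also degenerate spans $\emptyset$ and $\mathbb{Z}_n$. A nondegenerate $(a,l)$ is a span of a cycle $(\mathbf{v},\boldsymbol{\alpha})$ if $\{i:v_i\ne0\}\subseteq(a,a+l]$ and $\{i:\alpha_i\ne0\}\subseteq[a,a+l]$; $\emptyset$ is a span only of the zero cycle and $\mathbb{Z}_n$ of every cycle. $\mathbb{S}_{\mathfrak{s}}(T)$ is the subspace of cycles having span $\mathfrak{s}$ and $C_{\mathfrak{s}}(T):=L(\mathbb{S}_{\mathfrak{s}}(T))$. *)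

theory Defs
  imports Complex_Main "HOL-Library.Function_Algebras" "HOL-Library.Product_Plus"
begin

text \<open>A linear trellis of length n over the field 'f.  Indices of Z_n are represented
  by the naturals 0..n-1, the successor of i being Suc i mod n.  All vertex spaces V i
  are subspaces of one ambient 'f-vector space 'v (with scalar multiplication sc);
  the formal disjointness of the V i is implicit in the index i.
  Edges of section i are triples (v, alpha, w) with v in V i and w in V (i+1).\<close>

definition nxt :: "nat \<Rightarrow> nat \<Rightarrow> nat" where
  "nxt n i = Suc i mod n"

definition prv :: "nat \<Rightarrow> nat \<Rightarrow> nat" where
  "prv n i = (i + n - 1) mod n"

definition linear_trellis ::
  "('f::field \<Rightarrow> 'v::ab_group_add \<Rightarrow> 'v) \<Rightarrow> nat \<Rightarrow> (nat \<Rightarrow> 'v set)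
     \<Rightarrow> (nat \<Rightarrow> ('v \<times> 'f \<times> 'v) set) \<Rightarrow> bool" where
  "linear_trellis sc n V E \<longleftrightarrow>
     n \<ge> 1 \<and> vector_space sc \<and>
     (\<forall>i<n. finite (V i) \<and> module.subspace sc (V i) \<and>
        E i \<subseteq> V i \<times> UNIV \<times> V (nxt n i) \<and>
        (0, 0, 0) \<in> E i \<and>
        (\<forall>v a w v' a' w'. (v, a, w) \<in> E i \<longrightarrow> (v', a', w') \<in> E i \<longrightarrow>
            (v + v', a + a', w + w') \<in> E i) \<and>
        (\<forall>c v a w. (v, a, w) \<in> E i \<longrightarrow> (sc c v, c * a, sc c w) \<in> E i) \<and>
        (\<forall>v\<in>V i. (\<exists>a w. (v, a, w) \<in> E i) \<and> (\<exists>u a. (u, a, v) \<in> E (prv n i))))"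

definition cycles ::
  "nat \<Rightarrow> (nat \<Rightarrow> ('v::zero \<times> 'f::zero \<times> 'v) set) \<Rightarrow> ((nat \<Rightarrow> 'v) \<times> (nat \<Rightarrow> 'f)) set" where
  "cycles n E = {(v, a). (\<forall>i<n. (v i, a i, v (nxt n i)) \<in> E i) \<and>
                         (\<forall>i\<ge>n. v i = 0 \<and> a i = 0)}"

definition cyc_scale ::
  "('f::times \<Rightarrow> 'v \<Rightarrow> 'v) \<Rightarrow> 'f \<Rightarrow> (nat \<Rightarrow> 'v) \<times> (nat \<Rightarrow> 'f) \<Rightarrow> (nat \<Rightarrow> 'v) \<times> (nat \<Rightarrow> 'f)" where
  "cyc_scale sc c x = ((\<lambda>i. sc c (fst x i)), (\<lambda>i. c * snd x i))"

definition reduced :: "nat \<Rightarrow> (nat \<Rightarrow> ('v::zero \<times> 'f::zero \<times> 'v) set) \<Rightarrow> bool" where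
  "reduced n E \<longleftrightarrow>
     (\<forall>i<n. \<forall>e\<in>E i. \<exists>(v, a)\<in>cycles n E. e = (v i, a i, v (nxt n i)))"

definition one_to_one :: "nat \<Rightarrow> (nat \<Rightarrow> ('v::zero \<times> 'f::zero \<times> 'v) set) \<Rightarrow> bool" where
  "one_to_one n E \<longleftrightarrow> inj_on snd (cycles n E)"

datatype span = SpanEmpty | SpanAll | Span nat nat

definition is_span :: "nat \<Rightarrow> span \<Rightarrow> bool" where
  "is_span n s = (case s of Span a l \<Rightarrow> a < n \<and> l \<le> n - 1 | _ \<Rightarrow> True)"

definition cinterval :: "nat \<Rightarrow> nat \<Rightarrow> nat \<Rightarrow> nat set" where
  "cinterval n a l = {(a + j) mod n | j. j \<le> l}"

definition ointerval :: "nat \<Rightarrow> nat \<Rightarrow> nat \<Rightarrow> nat set" where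
  "ointerval n a l = cinterval n a l - {a}"

definition has_span :: "nat \<Rightarrow> span \<Rightarrow> (nat \<Rightarrow> 'v::zero) \<times> (nat \<Rightarrow> 'f::zero) \<Rightarrow> bool" where
  "has_span n s x = (case s of
      SpanEmpty \<Rightarrow> x = (0, 0)
    | SpanAll \<Rightarrow> True
    | Span a l \<Rightarrow> {i. i < n \<and> fst x i \<noteq> 0} \<subseteq> ointerval n a l \<and>
                  {i. i < n \<and> snd x i \<noteq> 0} \<subseteq> cinterval n a l)"

definition span_cycles ::
  "nat \<Rightarrow> (nat \<Rightarrow> ('v::zero \<times> 'f::zero \<times> 'v) set) \<Rightarrow> span \<Rightarrow> ((nat \<Rightarrow> 'v) \<times> (nat \<Rightarrow> 'f)) set" where
  "span_cycles n E s = {x \<in> cycles n E. has_span n s x}"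

definition span_code ::
  "nat \<Rightarrow> (nat \<Rightarrow> ('v::zero \<times> 'f::zero \<times> 'v) set) \<Rightarrow> span \<Rightarrow> (nat \<Rightarrow> 'f) set" where
  "span_code n E s = snd ` span_cycles n E s"

definition lin_iso ::
  "('f::field \<Rightarrow> 'v::ab_group_add \<Rightarrow> 'v) \<Rightarrow> ('f \<Rightarrow> 'w::ab_group_add \<Rightarrow> 'w) \<Rightarrow> nat
    \<Rightarrow> (nat \<Rightarrow> 'v set) \<Rightarrow> (nat \<Rightarrow> ('v \<times> 'f \<times> 'v) set)
    \<Rightarrow> (nat \<Rightarrow> 'w set) \<Rightarrow> (nat \<Rightarrow> ('w \<times> 'f \<times> 'w) set) \<Rightarrow> (nat \<Rightarrow> 'v \<Rightarrow> 'w) \<Rightarrow> bool" where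
  "lin_iso sc sc' n V E V' E' f \<longleftrightarrow>
     (\<forall>i<n. bij_betw (f i) (V i) (V' i) \<and>
        (\<forall>x\<in>V i. \<forall>y\<in>V i. f i (x + y) = f i x + f i y) \<and>
        (\<forall>c. \<forall>x\<in>V i. f i (sc c x) = sc' c (f i x)) \<and>
        (\<forall>v\<in>V i. \<forall>w\<in>V (nxt n i). \<forall>a.
            (v, a, w) \<in> E i \<longleftrightarrow> (f i v, a, f (nxt n i) w) \<in> E' i))"

definition lin_isomorphic ::
  "('f::field \<Rightarrow> 'v::ab_group_add \<Rightarrow> 'v) \<Rightarrow> ('f \<Rightarrow> 'w::ab_group_add \<Rightarrow> 'w) \<Rightarrow> nat
    \<Rightarrow> (nat \<Rightarrow> 'v set) \<Rightarrow> (nat \<Rightarrow> ('v \<times> 'f \<times> 'v) set)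
    \<Rightarrow> (nat \<Rightarrow> 'w set) \<Rightarrow> (nat \<Rightarrow> ('w \<times> 'f \<times> 'w) set) \<Rightarrow> bool" where
  "lin_isomorphic sc sc' n V E V' E' \<longleftrightarrow> (\<exists>f. lin_iso sc sc' n V E V' E' f)"

end

theory Submission
  imports Defs "HOL-Library.Cardinality"
begin

text \<open>
  An isomorphism of reduced trellises amounts to a label-preserving linear isomorphism of the cycle
  spaces that respects, for every \<open>i\<close>, the subspace of cycles vanishing at vertex \<open>i\<close>. It is built by
  induction on the length of spans. If cycles \<open>d i\<close> with spans \<open>(i, m)\<close> sum to zero, their partial sums
  can be glued to one cycle, and this forces every \<open>d i\<close> to be a sum of cycles with the shorter spans
  \<open>(i, m - 1)\<close> and \<open>(i + 1, m - 1)\<close>. Hence isomorphisms chosen separately on the spaces of cycles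
  of span \<open>(i, m)\<close>, all extending the one already built, combine to an isomorphism on their sum.
  Each such extension exists because equal dimensions and equal label spaces also make the kernels
  of the label maps equally large.
\<close>

section \<open>Label-preserving isomorphisms of subspaces\<close>

lemma (in vector_space) card_span_independent:
  assumes "finite (UNIV :: 'a set)" "finite B" "independent B"
  shows "card (span B) = CARD('a) ^ card B"
  using assms(2,3)
proof (induction B rule: finite_induct)
  case empty
  then show ?case by simp
next
  case (insert b B)
  then have indep: "independent B" and b: "b \<notin> span B"
    by (auto simp: independent_insert)
  let ?h = "\<lambda>(k, x). scale k b + x"
  have "span (insert b B) = ?h ` (UNIV \<times> span B)"
  proof (intro equalityI subsetI)
    fix x assume "x \<in> span (insert b B)"
    then obtain k where "x - scale k b \<in> span B"
      by (auto simp: span_breakdown_eq)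
    then show "x \<in> ?h ` (UNIV \<times> span B)"
      by (intro image_eqI[of _ _ "(k, x - scale k b)"]) auto
  qed (auto intro!: span_add span_scale intro: span_base subsetD[OF span_mono[OF subset_insertI]])
  moreover have "inj_on ?h (UNIV \<times> span B)"
  proof (rule inj_onI, clarify)
    fix k x k' x'
    assume x: "x \<in> span B" "x' \<in> span B" and eq: "scale k b + x = scale k' b + x'"
    then have *: "scale (k - k') b = x' - x"
      by (simp add: scale_left_diff_distrib algebra_simps)
    have "k = k'"
    proof (rule ccontr)
      assume "k \<noteq> k'"
      then have "b = scale (inverse (k - k')) (scale (k - k') b)"
        by simp
      also have "\<dots> \<in> span B"
        unfolding * using x by (intro span_scale span_diff)
      finally show False using b by simp
    qed
    then show "k = k' \<and> x = x'" using eq by simp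
  qed
  ultimately show ?case
    using insert indep by (simp add: card_image card_cartesian_product)
qed

lemma (in vector_space) card_subspace:
  assumes "finite (UNIV :: 'a set)" "finite S" "subspace S"
  shows "card S = CARD('a) ^ dim S"
proof -
  obtain B where B: "B \<subseteq> S" "independent B" "S \<subseteq> span B" "card B = dim S"
    by (rule basis_exists)
  then have "span B = S" using assms by (simp add: span_subspace)
  then show ?thesis
    using card_span_independent[of B] B assms finite_subset by fastforce
qed

text \<open>Both cardinalities are powers of \<open>CARD('f)\<close>, which exceeds 1, so they
  determine the exponents. Everything below works with cardinalities, which bijections and counting
  of fibres control directly.\<close>

lemma dim_eq_iff_card_eq:
  fixes s1 :: "'f::{field,finite} \<Rightarrow> 'x::ab_group_add \<Rightarrow> 'x"
    and s2 :: "'f \<Rightarrow> 'y::ab_group_add \<Rightarrow> 'y"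
  assumes "vector_space s1" "vector_space s2"
    and "finite S" "module.subspace s1 S" "finite S'" "module.subspace s2 S'"
  shows "vector_space.dim s1 S = vector_space.dim s2 S' \<longleftrightarrow> card S = card S'"
proof -
  have "card {0, 1 :: 'f} \<le> CARD('f)" by (rule card_mono) auto
  then have "1 < CARD('f)" by simp
  then show ?thesis
    using vector_space.card_subspace[of s1 S] vector_space.card_subspace[of s2 S'] assms
    by simp
qed

text \<open>Every nonempty fibre of \<open>L\<close> is a translate of the kernel. The formula
  serves to compare the kernels of two label maps that have equal domain sizes and equal
  images.\<close>

lemma card_eq_kernel_times_image:
  fixes L :: "'x::ab_group_add \<Rightarrow> 'l::ab_group_add"
  assumes "finite U" and diff: "\<And>x y. x \<in> U \<Longrightarrow> y \<in> U \<Longrightarrow> x - y \<in> U"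
    and add: "\<And>x y. x \<in> U \<Longrightarrow> y \<in> U \<Longrightarrow> x + y \<in> U"
    and L: "\<And>x y. L (x + y) = L x + L y"
  shows "card U = card (L ` U) * card {x \<in> U. L x = 0}"
proof -
  have Ld: "L (x - y) = L x - L y" for x y
    using L[of "x - y" y] by (simp add: algebra_simps)
  have "card {x \<in> U. L x = l} = card {x \<in> U. L x = 0}" if l: "l \<in> L ` U" for l
  proof -
    obtain u where u: "u \<in> U" "l = L u" using l by blast
    have "bij_betw (\<lambda>x. x - u) {x \<in> U. L x = l} {x \<in> U. L x = 0}"
      by (rule bij_betw_byWitness[of _ "\<lambda>x. x + u"]) (use u diff add L Ld in auto)
    then show ?thesis by (rule bij_betw_same_card)
  qed
  moreover have "card U = (\<Sum>l\<in>L ` U. card {x \<in> U. L x = l})"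
    using sum.image_gen[OF \<open>finite U\<close>, of "\<lambda>_. 1::nat" L] by simp
  ultimately show ?thesis by simp
qed

text \<open>To be instantiated with the two cycle spaces and \<open>snd\<close> as both label maps.
  The abstract setting keeps the linear algebra apart from the arithmetic of cyclic indices.\<close>

locale labelled_spaces = vs1: vector_space s1 + vs2: vector_space s2
  for s1 :: "'f::{field,finite} \<Rightarrow> 'x::ab_group_add \<Rightarrow> 'x"
    and s2 :: "'f \<Rightarrow> 'y::ab_group_add \<Rightarrow> 'y" +
  fixes sl :: "'f \<Rightarrow> 'l::ab_group_add \<Rightarrow> 'l"
    and L1 :: "'x \<Rightarrow> 'l" and L2 :: "'y \<Rightarrow> 'l"
  assumes L1_add: "L1 (x + x') = L1 x + L1 x'" and L1_scale: "L1 (s1 c x) = sl c (L1 x)"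
    and L2_add: "L2 (y + y') = L2 y + L2 y'" and L2_scale: "L2 (s2 c y) = sl c (L2 y)"
begin

sublocale prod: vector_space "\<lambda>c p. (s1 c (fst p), s2 c (snd p))"
  by unfold_locales
    (auto simp: vs1.scale_right_distrib vs1.scale_left_distrib
      vs2.scale_right_distrib vs2.scale_left_distrib)

text \<open>Label-preserving linear isomorphisms between subspaces are handled through their graphs.\<close>

definition partial_iso :: "('x \<times> 'y) set \<Rightarrow> bool" where
  "partial_iso G \<longleftrightarrow> prod.subspace G \<and>
     (\<forall>(x, y)\<in>G. L1 x = L2 y \<and> (x = 0 \<longleftrightarrow> y = 0))"

lemma L1_zero: "L1 0 = 0" and L2_zero: "L2 0 = 0"
  using L1_add[of 0 0] L2_add[of 0 0] by simp_all

lemma L1_diff: "L1 (x - x') = L1 x - L1 x'"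
  using L1_add[of "x - x'" x'] by (simp add: algebra_simps)

lemma partial_iso_zero: "partial_iso {0}"
  unfolding partial_iso_def using prod.subspace_single_0
  by (simp add: L1_zero L2_zero zero_prod_def del: prod.subspace_single_0)

lemma partial_iso_0: "partial_iso G \<Longrightarrow> (0, 0) \<in> G"
  unfolding partial_iso_def using prod.subspace_0[of G] by (simp add: zero_prod_def)

lemma partial_iso_add:
  "partial_iso G \<Longrightarrow> (x, y) \<in> G \<Longrightarrow> (x', y') \<in> G \<Longrightarrow> (x + x', y + y') \<in> G"
  unfolding partial_iso_def using prod.subspace_add[of G "(x, y)" "(x', y')"] by simp

lemma partial_iso_scale:
  "partial_iso G \<Longrightarrow> (x, y) \<in> G \<Longrightarrow> (s1 c x, s2 c y) \<in> G"
  unfolding partial_iso_def using prod.subspace_scale[of G "(x, y)" c] by simp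

lemma partial_iso_diff:
  "partial_iso G \<Longrightarrow> (x, y) \<in> G \<Longrightarrow> (x', y') \<in> G \<Longrightarrow> (x - x', y - y') \<in> G"
  unfolding partial_iso_def using prod.subspace_diff[of G "(x, y)" "(x', y')"] by simp

lemma partial_iso_zero_iff: "partial_iso G \<Longrightarrow> (x, y) \<in> G \<Longrightarrow> x = 0 \<longleftrightarrow> y = 0"
  unfolding partial_iso_def by blast

lemma partial_iso_label: "partial_iso G \<Longrightarrow> (x, y) \<in> G \<Longrightarrow> L1 x = L2 y"
  unfolding partial_iso_def by auto

text \<open>The zero condition applied to the difference of the two pairs. This makes a partial
  isomorphism the graph of an injective map.\<close>

lemma partial_iso_unique:
  assumes "partial_iso G" "(x, y) \<in> G" "(x', y') \<in> G"
  shows "x = x' \<longleftrightarrow> y = y'"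
  using partial_iso_zero_iff[OF assms(1) partial_iso_diff[OF assms]] by simp

lemma partial_iso_sum:
  assumes "partial_iso G" "\<And>i. i \<in> I \<Longrightarrow> (x i, y i) \<in> G"
  shows "(sum x I, sum y I) \<in> G"
proof -
  have "(\<Sum>i\<in>I. (x i, y i)) \<in> G"
    using assms unfolding partial_iso_def by (blast intro: prod.subspace_sum)
  then show ?thesis by (simp add: sum_prod)
qed

lemma partial_iso_Int:
  assumes "partial_iso G" "vs1.subspace U" "vs2.subspace U'"
  shows "partial_iso (G \<inter> U \<times> U')"
proof -
  have "prod.subspace (G \<inter> U \<times> U')"
    using assms unfolding partial_iso_def prod.subspace_def vs1.subspace_def vs2.subspace_def
    by (auto simp: zero_prod_def)
  then show ?thesis using assms(1) unfolding partial_iso_def by auto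
qed

lemma card_partial_iso:
  assumes "partial_iso G"
  shows "card (fst ` G) = card (snd ` G)"
proof -
  have "inj_on fst G" "inj_on snd G"
    using partial_iso_unique[OF assms] by (auto intro!: inj_onI)
  then show ?thesis by (simp add: card_image)
qed

text \<open>Extension by one dimension, sending \<open>u\<close> to \<open>u'\<close>. The zero
  condition survives because a relation \<open>x + s1 c u = 0\<close> with nonzero \<open>c\<close>
  would put \<open>u\<close> into the domain of \<open>G\<close>, and likewise \<open>u'\<close>
  into its range.\<close>

lemma partial_iso_insert:
  assumes G: "partial_iso G" and u: "u \<notin> fst ` G" and u': "u' \<notin> snd ` G"
    and L: "L1 u = L2 u'"
  shows "partial_iso {(x + s1 c u, y + s2 c u') | x y c. (x, y) \<in> G}" (is "partial_iso ?H")
proof -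
  have H: "(x + s1 c u, y + s2 c u') \<in> ?H" if "(x, y) \<in> G" for x y c
    using that by blast
  have "prod.subspace ?H"
  proof (rule prod.subspaceI)
    show "0 \<in> ?H"
      using H[OF partial_iso_0[OF G], of 0] by (simp add: zero_prod_def)
  next
    fix p q assume "p \<in> ?H" "q \<in> ?H"
    then obtain x y c x' y' c' where "(x, y) \<in> G" "(x', y') \<in> G"
      and pq: "p = (x + s1 c u, y + s2 c u')" "q = (x' + s1 c' u, y' + s2 c' u')"
      by blast
    then have "(x + x' + s1 (c + c') u, y + y' + s2 (c + c') u') \<in> ?H"
      by (intro H partial_iso_add[OF G])
    then show "p + q \<in> ?H"
      by (simp add: pq vs1.scale_left_distrib vs2.scale_left_distrib ac_simps)
  next
    fix d p assume "p \<in> ?H"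
    then obtain x y c where "(x, y) \<in> G" and p: "p = (x + s1 c u, y + s2 c u')"
      by blast
    then have "(s1 d x + s1 (d * c) u, s2 d y + s2 (d * c) u') \<in> ?H"
      by (intro H partial_iso_scale[OF G])
    then show "(s1 d (fst p), s2 d (snd p)) \<in> ?H"
      by (simp add: p vs1.scale_right_distrib vs2.scale_right_distrib)
  qed
  moreover have "x + s1 c u = 0 \<longleftrightarrow> y + s2 c u' = 0" if xy: "(x, y) \<in> G" for x y c
  proof (cases "c = 0")
    case True
    then show ?thesis using partial_iso_zero_iff[OF G xy] by simp
  next
    case False
    have mem: "(s1 (- inverse c) x, s2 (- inverse c) y) \<in> G"
      using partial_iso_scale[OF G xy] .
    have "x + s1 c u \<noteq> 0"
    proof
      assume "x + s1 c u = 0"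
      then have "x = - s1 c u" by (simp add: eq_neg_iff_add_eq_0)
      then have "s1 (- inverse c) x = u" using False by simp
      then show False using mem u by force
    qed
    moreover have "y + s2 c u' \<noteq> 0"
    proof
      assume "y + s2 c u' = 0"
      then have "y = - s2 c u'" by (simp add: eq_neg_iff_add_eq_0)
      then have "s2 (- inverse c) y = u'" using False by simp
      then show False using mem u' by force
    qed
    ultimately show ?thesis by simp
  qed
  moreover have "L1 (x + s1 c u) = L2 (y + s2 c u')" if "(x, y) \<in> G" for x y c
    using partial_iso_label[OF G that] by (simp add: L1_add L2_add L1_scale L2_scale L)
  ultimately show ?thesis unfolding partial_iso_def by auto
qed

text \<open>A maximal partial isomorphism \<open>H\<close> between \<open>G\<close> and
  \<open>U \<times> U'\<close> is taken, which exists by finiteness. If its domain missed some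
  element of \<open>U\<close>, a pair with equal labels could be found outside both domain and
  range, and \<open>partial_iso_insert\<close> would contradict maximality. That the range is
  \<open>U'\<close> then follows by counting.\<close>

lemma partial_iso_extends:
  assumes G: "partial_iso G" "G \<subseteq> U \<times> U'"
    and U: "finite U" "vs1.subspace U" and U': "finite U'" "vs2.subspace U'"
    and card: "card U = card U'" and L: "L1 ` U = L2 ` U'"
  obtains H where "partial_iso H" "G \<subseteq> H" "fst ` H = U" "snd ` H = U'"
proof -
  let ?P = "\<lambda>H. partial_iso H \<and> G \<subseteq> H \<and> H \<subseteq> U \<times> U'"
  have "finite (Collect ?P)"
    by (rule finite_subset[of _ "Pow (U \<times> U')"]) (use U U' in auto)
  then obtain H where "?P H" and max: "\<And>H'. ?P H' \<Longrightarrow> H \<subseteq> H' \<Longrightarrow> H' = H"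
    using finite_has_maximal2[of "Collect ?P" G] G by (smt (verit) mem_Collect_eq order_refl)
  then have H: "partial_iso H" "G \<subseteq> H" "H \<subseteq> U \<times> U'" by auto
  have no_insert: False
    if "u \<in> U" "u' \<in> U'" "u \<notin> fst ` H" "u' \<notin> snd ` H" "L1 u = L2 u'" for u u'
  proof -
    let ?H = "{(x + s1 c u, y + s2 c u') | x y c. (x, y) \<in> H}"
    have "H \<subseteq> ?H"
    proof clarify
      fix x y assume "(x, y) \<in> H"
      then show "\<exists>x' y' c. (x, y) = (x' + s1 c u, y' + s2 c u') \<and> (x', y') \<in> H"
        by (intro exI[of _ x] exI[of _ y] exI[of _ 0]) simp
    qed
    moreover have "?H \<subseteq> U \<times> U'"
      using H(3) that U U' by (auto intro!: vs1.subspace_add vs2.subspace_add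
          vs1.subspace_scale vs2.subspace_scale)
    ultimately have "?H = H"
      using max partial_iso_insert[OF H(1) that(3-5)] H(2) by blast
    moreover have "(u, u') \<in> ?H"
      using partial_iso_0[OF H(1)] by (auto intro!: exI[of _ 0] exI[of _ 1])
    ultimately show False using that(3) by force
  qed
  have "u \<in> fst ` H" if u: "u \<in> U" for u
  proof (rule ccontr)
    assume nu: "u \<notin> fst ` H"
    show False
    proof (cases "L1 u \<in> L1 ` fst ` H")
      \<comment> \<open>The label of \<open>u\<close> does not yet occur, so an element
        \<open>u'\<close> with this label cannot be in the range of \<open>H\<close>: its partner
        would carry the same label.\<close>
      case False
      obtain u' where u': "u' \<in> U'" "L1 u = L2 u'" using L u by blast
      then have "u' \<notin> snd ` H" using False partial_iso_label[OF H(1)] by force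
      then show False using no_insert u u' nu by blast
    next
      \<comment> \<open>Subtracting a domain element with the same label turns \<open>u\<close> into
        a kernel element that is still outside the domain. It remains to find a kernel element of
        \<open>U'\<close> outside the range.\<close>
      case True
      then obtain x y where xy: "(x, y) \<in> H" "L1 x = L1 u" by fastforce
      let ?K = "{x \<in> U. L1 x = 0}" and ?K' = "{y \<in> U'. L2 y = 0}"
      have k: "u - x \<in> ?K"
        using xy u H(3) U by (auto simp: L1_diff intro: vs1.subspace_diff)
      have nk: "u - x \<notin> fst ` H"
      proof
        assume "u - x \<in> fst ` H"
        then obtain z where "(u - x, z) \<in> H" by auto
        then have "(u - x + x, z + y) \<in> H" using partial_iso_add H(1) xy by blast
        then show False using nu by force
      qed
      have "card U = card (L1 ` U) * card ?K"
        using card_eq_kernel_times_image[of U L1] U L1_add vs1.subspace_diff vs1.subspace_add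
        by blast
      moreover have "card U' = card (L2 ` U') * card ?K'"
        using card_eq_kernel_times_image[of U' L2] U' L2_add vs2.subspace_diff vs2.subspace_add
        by blast
      moreover have "card (L1 ` U) \<noteq> 0" using U u by auto
      ultimately have KK': "card ?K = card ?K'" using card L by simp
      \<comment> \<open>The part of \<open>H\<close> between the two kernels. Its domain is a proper
        subset of \<open>?K\<close>, its range has the same size, and the kernels are equally large,
        so its range cannot exhaust \<open>?K'\<close>.\<close>
      let ?H0 = "{p \<in> H. L1 (fst p) = 0}"
      have "inj_on fst ?H0" "inj_on snd ?H0"
        using partial_iso_unique[OF H(1)] by (auto intro!: inj_onI)
      then have "card (snd ` ?H0) = card (fst ` ?H0)"
        by (simp add: card_image)
      also have "\<dots> < card ?K"
        using U k nk H(3) by (intro psubset_card_mono) auto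
      finally have "card (snd ` ?H0) < card ?K'" using KK' by simp
      moreover have "finite (snd ` ?H0)"
        using finite_subset[OF H(3)] U(1) U'(1) by simp
      ultimately have "\<not> ?K' \<subseteq> snd ` ?H0"
        using card_mono leD by blast
      then obtain k' where k': "k' \<in> ?K'" "k' \<notin> snd ` ?H0" by blast
      have "k' \<notin> snd ` H"
      proof
        assume "k' \<in> snd ` H"
        then obtain z where z: "(z, k') \<in> H" by auto
        then have "(z, k') \<in> ?H0" using partial_iso_label[OF H(1) z] k'(1) by simp
        then show False using k'(2) by force
      qed
      then show False using no_insert[of "u - x" k'] k nk k' by simp
    qed
  qed
  then have fst: "fst ` H = U" using H(3) by force
  moreover have "snd ` H = U'"
  proof (rule card_subset_eq[OF U'(1)])
    show "snd ` H \<subseteq> U'" using H(3) by force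
    show "card (snd ` H) = card U'" using card_partial_iso[OF H(1)] fst card by simp
  qed
  ultimately show thesis using that H by blast
qed

section \<open>Gluing isomorphisms of several subspaces\<close>

text \<open>For a partial isomorphism \<open>G\<close> this says that \<open>G\<close> restricts to
  a bijection from \<open>A\<close> onto \<open>A'\<close>. Intersecting with
  \<open>A \<times> A'\<close> forces the partners into the right set while \<open>G\<close> itself
  may be larger.\<close>

definition matches :: "('x \<times> 'y) set \<Rightarrow> 'x set \<Rightarrow> 'y set \<Rightarrow> bool" where
  "matches G A A' \<longleftrightarrow> A \<subseteq> fst ` (G \<inter> A \<times> A') \<and> A' \<subseteq> snd ` (G \<inter> A \<times> A')"

lemma matches_obtain1: assumes "matches G A A'" "x \<in> A" obtains y where "y \<in> A'" "(x, y) \<in> G"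
  using assms unfolding matches_def by fastforce

lemma matches_obtain2: assumes "matches G A A'" "y \<in> A'" obtains x where "x \<in> A" "(x, y) \<in> G"
  using assms unfolding matches_def by fastforce

lemma matches_mono: "matches G A A' \<Longrightarrow> G \<inter> A \<times> A' \<subseteq> H \<Longrightarrow> matches H A A'"
  unfolding matches_def by blast

text \<open>An element of \<open>A\<close> has a partner in \<open>A'\<close>, and by uniqueness
  that partner is \<open>y\<close>; the other direction is symmetric. This finally transfers
  vanishing at a vertex from one cycle to its partner.\<close>

lemma matches_iff:
  assumes "partial_iso G" "matches G A A'" "(x, y) \<in> G"
  shows "x \<in> A \<longleftrightarrow> y \<in> A'"
  using matches_obtain1[OF assms(2), of x] matches_obtain2[OF assms(2), of y]
    partial_iso_unique[OF assms(1,3)] by metis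

text \<open>The only obstacle to adding up the graphs \<open>H i\<close> is a sum that vanishes on
  one side but not on the other. By \<open>syz1\<close> and \<open>syz2\<close> all pairs of such a
  family lie in the single partial isomorphism \<open>G\<close>, hence so does the pair of sums, and
  the zero condition of \<open>G\<close> applies.\<close>

lemma partial_iso_glue:
  assumes G: "partial_iso G" and H: "\<And>i. i \<in> I \<Longrightarrow> partial_iso (H i)"
    and syz1: "\<And>x y i. (\<And>i. i \<in> I \<Longrightarrow> (x i, y i) \<in> H i) \<Longrightarrow> sum x I = 0 \<Longrightarrow> i \<in> I \<Longrightarrow> (x i, y i) \<in> G"
    and syz2: "\<And>x y i. (\<And>i. i \<in> I \<Longrightarrow> (x i, y i) \<in> H i) \<Longrightarrow> sum y I = 0 \<Longrightarrow> i \<in> I \<Longrightarrow> (x i, y i) \<in> G"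
  shows "partial_iso {(sum x I, sum y I) | x y. \<forall>i\<in>I. (x i, y i) \<in> H i}" (is "partial_iso ?S")
proof -
  have S: "(sum x I, sum y I) \<in> ?S" if "\<And>i. i \<in> I \<Longrightarrow> (x i, y i) \<in> H i" for x y
    using that by blast
  have "prod.subspace ?S"
  proof (rule prod.subspaceI)
    show "0 \<in> ?S"
      using S[of "\<lambda>_. 0" "\<lambda>_. 0"] H by (simp add: zero_prod_def partial_iso_0)
  next
    fix p q assume "p \<in> ?S" "q \<in> ?S"
    then obtain x y x' y' where "\<forall>i\<in>I. (x i, y i) \<in> H i" "\<forall>i\<in>I. (x' i, y' i) \<in> H i"
      and pq: "p = (sum x I, sum y I)" "q = (sum x' I, sum y' I)"
      by blast
    then have "(\<Sum>i\<in>I. x i + x' i, \<Sum>i\<in>I. y i + y' i) \<in> ?S"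
      by (intro S partial_iso_add H) auto
    then show "p + q \<in> ?S"
      by (simp add: pq sum.distrib)
  next
    fix c p assume "p \<in> ?S"
    then obtain x y where "\<forall>i\<in>I. (x i, y i) \<in> H i" and p: "p = (sum x I, sum y I)"
      by blast
    then have "(\<Sum>i\<in>I. s1 c (x i), \<Sum>i\<in>I. s2 c (y i)) \<in> ?S"
      by (intro S partial_iso_scale H) auto
    then show "(s1 c (fst p), s2 c (snd p)) \<in> ?S"
      by (simp add: p vs1.scale_sum_right vs2.scale_sum_right)
  qed
  moreover have "L1 (sum x I) = L2 (sum y I) \<and> (sum x I = 0 \<longleftrightarrow> sum y I = 0)"
    if xy: "\<forall>i\<in>I. (x i, y i) \<in> H i" for x y
  proof -
    have "L1 (sum x J) = L2 (sum y J)" if "finite J" "J \<subseteq> I" for J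
      using that
    proof (induction J rule: finite_induct)
      case (insert i J)
      then show ?case
        using xy partial_iso_label[OF H, of i] by (auto simp: L1_add L2_add)
    qed (simp add: L1_zero L2_zero)
    \<comment> \<open>For infinite \<open>I\<close> both sums are 0 by convention.\<close>
    then have "L1 (sum x I) = L2 (sum y I)"
      by (cases "finite I") (simp_all add: L1_zero L2_zero)
    moreover have "(sum x I, sum y I) \<in> G" if "sum x I = 0 \<or> sum y I = 0"
      using that xy syz1[of x y] syz2[of x y] by (intro partial_iso_sum[OF G]) blast
    ultimately show ?thesis using partial_iso_zero_iff[OF G] by blast
  qed
  ultimately show ?thesis unfolding partial_iso_def by auto
qed

text \<open>For each \<open>i\<close> the restriction of \<open>G\<close> to
  \<open>U i \<times> U' i\<close> is extended to an isomorphism \<open>H i\<close>, and the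
  \<open>H i\<close> are glued. The members of a vanishing sum have partners under \<open>G\<close>
  in the right subspaces; as \<open>H i\<close> extends that restriction, these are also their
  partners under \<open>H i\<close>, which is what \<open>partial_iso_glue\<close> asks for.\<close>

lemma partial_iso_matching:
  assumes I: "finite I" and G: "partial_iso G"
    and U: "\<And>i. i \<in> I \<Longrightarrow> finite (U i) \<and> vs1.subspace (U i)"
    and U': "\<And>i. i \<in> I \<Longrightarrow> finite (U' i) \<and> vs2.subspace (U' i)"
    and card: "\<And>i. i \<in> I \<Longrightarrow> card (U i) = card (U' i)"
    and L: "\<And>i. i \<in> I \<Longrightarrow> L1 ` U i = L2 ` U' i"
    and syz1: "\<And>x i. (\<And>i. i \<in> I \<Longrightarrow> x i \<in> U i) \<Longrightarrow> sum x I = 0 \<Longrightarrow> i \<in> I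
      \<Longrightarrow> \<exists>y \<in> U' i. (x i, y) \<in> G"
    and syz2: "\<And>y i. (\<And>i. i \<in> I \<Longrightarrow> y i \<in> U' i) \<Longrightarrow> sum y I = 0 \<Longrightarrow> i \<in> I
      \<Longrightarrow> \<exists>x \<in> U i. (x, y i) \<in> G"
  obtains G' where "partial_iso G'" "\<And>i. i \<in> I \<Longrightarrow> matches G' (U i) (U' i)"
proof -
  have "\<exists>H. partial_iso H \<and> G \<inter> U i \<times> U' i \<subseteq> H \<and> fst ` H = U i \<and> snd ` H = U' i" if i: "i \<in> I" for i
    using partial_iso_extends[OF partial_iso_Int[OF G, of "U i" "U' i"], of "U i" "U' i"]
      U[OF i] U'[OF i] card[OF i] L[OF i] by (metis inf_le2)
  then obtain H where H: "\<And>i. i \<in> I \<Longrightarrow> partial_iso (H i)"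
    and GH: "\<And>i. i \<in> I \<Longrightarrow> G \<inter> U i \<times> U' i \<subseteq> H i"
    and dom: "\<And>i. i \<in> I \<Longrightarrow> fst ` H i = U i" and ran: "\<And>i. i \<in> I \<Longrightarrow> snd ` H i = U' i"
    by metis
  have mem1: "x \<in> U i" and mem2: "y \<in> U' i" if "(x, y) \<in> H i" "i \<in> I" for x y i
    using dom ran that by force+
  let ?S = "{(sum x I, sum y I) | x y. \<forall>i\<in>I. (x i, y i) \<in> H i}"
  have "partial_iso ?S"
  proof (rule partial_iso_glue[OF G H])
    fix x y i assume xy: "\<And>i. i \<in> I \<Longrightarrow> (x i, y i) \<in> H i" and i: "i \<in> I"
    show "(x i, y i) \<in> G" if "sum x I = 0"
    proof -
      obtain z where "z \<in> U' i" "(x i, z) \<in> G"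
        using syz1[of x i] mem1 xy \<open>sum x I = 0\<close> i by blast
      moreover from this have "(x i, z) \<in> H i" using GH[OF i] mem1[OF xy[OF i] i] by blast
      ultimately show ?thesis using partial_iso_unique[OF H[OF i] xy[OF i]] by blast
    qed
    show "(x i, y i) \<in> G" if "sum y I = 0"
    proof -
      obtain z where "z \<in> U i" "(z, y i) \<in> G"
        using syz2[of y i] mem2 xy \<open>sum y I = 0\<close> i by blast
      moreover from this have "(z, y i) \<in> H i" using GH[OF i] mem2[OF xy[OF i] i] by blast
      ultimately show ?thesis using partial_iso_unique[OF H[OF i] xy[OF i]] by blast
    qed
  qed
  moreover have HS: "(x, y) \<in> ?S" if i: "i \<in> I" and xy: "(x, y) \<in> H i" for i x y
  proof -
    \<comment> \<open>A family concentrated at \<open>i\<close> embeds \<open>H i\<close> into the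
      sum.\<close>
    let ?x = "\<lambda>j. if j = i then x else 0" and ?y = "\<lambda>j. if j = i then y else 0"
    have "\<forall>j\<in>I. (?x j, ?y j) \<in> H j" using xy partial_iso_0[OF H] by auto
    then have "(sum ?x I, sum ?y I) \<in> ?S"
      by (intro CollectI exI conjI) (rule refl)
    moreover have "sum ?x I = x" "sum ?y I = y" using I i by simp_all
    ultimately show ?thesis by (simp only:)
  qed
  moreover have "matches ?S (U i) (U' i)" if i: "i \<in> I" for i
  proof (rule matches_mono)
    show "matches (H i) (U i) (U' i)"
      unfolding matches_def using dom[OF i] ran[OF i] by force
    show "H i \<inter> U i \<times> U' i \<subseteq> ?S" using HS[OF i] by auto
  qed
  ultimately show thesis using that by blast
qed

end

section \<open>Cycles supported on an arc\<close>

text \<open>\<open>arc n E i 0\<close> is zero and \<open>arc n E i (Suc l)\<close> is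
  the space of cycles of span \<open>(i, l)\<close>, so that \<open>m\<close> counts the admissible label positions.\<close>

definition arc ::
  "nat \<Rightarrow> (nat \<Rightarrow> ('v::zero \<times> 'f::zero \<times> 'v) set) \<Rightarrow> nat \<Rightarrow> nat \<Rightarrow> ((nat \<Rightarrow> 'v) \<times> (nat \<Rightarrow> 'f)) set" where
  "arc n E i m = {x \<in> cycles n E. \<forall>j<n.
     (j = 0 \<or> m \<le> j \<longrightarrow> fst x ((i + j) mod n) = 0) \<and> (m \<le> j \<longrightarrow> snd x ((i + j) mod n) = 0)}"

lemma cycle_eq_zero_iff:
  assumes "x \<in> cycles n E"
  shows "x = 0 \<longleftrightarrow> (\<forall>i<n. fst x i = 0 \<and> snd x i = 0)"
proof -
  have "fst x i = 0 \<and> snd x i = 0" if "\<not> i < n" for i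
    using assms that unfolding cycles_def by auto
  moreover have "x = 0 \<longleftrightarrow> (\<forall>i. fst x i = 0 \<and> snd x i = 0)"
    by (auto simp: prod_eq_iff fun_eq_iff)
  ultimately show ?thesis by blast
qed

lemma arc_subset_cycles: "arc n E i m \<subseteq> cycles n E"
  unfolding arc_def by blast

lemma arc_mono: "m \<le> m' \<Longrightarrow> arc n E i m \<subseteq> arc n E i m'"
  unfolding arc_def by auto

text \<open>Starting points matter only modulo \<open>n\<close>, so the neighbouring arc may start
  at \<open>Suc i\<close> without reduction.\<close>

lemma arc_mod: "arc n E (i mod n) m = arc n E i m"
  unfolding arc_def by (simp add: mod_simps)

lemma arc_nxt: "arc n E (nxt n i) m = arc n E (Suc i) m"
  unfolding nxt_def by (rule arc_mod)

lemma index_offset: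
  fixes n :: nat
  assumes "i < n" "k < n" obtains j where "j < n" "k = (i + j) mod n"
proof (cases "i \<le> k")
  case True
  then show thesis using that[of "k - i"] assms by simp
next
  case False
  then show thesis using that[of "k + n - i"] assms by simp
qed

lemma offset_inject:
  fixes n :: nat
  assumes "i < n" "j < n" "j' < n" "(i + j) mod n = (i + j') mod n"
  shows "j = j'"
  using assms by (auto simp: mod_if split: if_splits)

lemma nxt_surj: assumes "i < n" obtains j where "j < n" "nxt n j = i"
  using assms that[of "i - 1"] that[of "n - 1"] by (cases i) (auto simp: nxt_def)

text \<open>Offset \<open>j\<close> from \<open>i\<close> is offset \<open>j - 1\<close> from
  \<open>Suc i\<close>. The vertex at \<open>i\<close> itself is at offset \<open>n - 1\<close> from
  \<open>Suc i\<close>, which lies beyond the shorter arc because \<open>m < n\<close>.\<close>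

lemma arc_Suc_subset:
  assumes "m < n" shows "arc n E (Suc i) m \<subseteq> arc n E i (Suc m)"
proof
  fix x assume x: "x \<in> arc n E (Suc i) m"
  show "x \<in> arc n E i (Suc m)"
    unfolding arc_def
  proof (intro CollectI conjI allI impI)
    show "x \<in> cycles n E" using x arc_subset_cycles by blast
    fix j assume j: "j < n"
    have a: "fst x ((Suc i + j) mod n) = 0 \<and> snd x ((Suc i + j) mod n) = 0" if "m \<le> j" "j < n" for j
      using x that unfolding arc_def by blast
    show "snd x ((i + j) mod n) = 0" if "Suc m \<le> j"
      using a[of "j - 1"] that j by simp
    show "fst x ((i + j) mod n) = 0" if "j = 0 \<or> Suc m \<le> j"
      using a[of "j - 1"] a[of "n - 1"] that j assms by auto
  qed
qed

text \<open>The first arc cuts off the last position of the second one, and the second excludes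
  position \<open>i\<close>. The bound \<open>Suc m < n\<close> ensures that the second arc does not
  wrap around to \<open>i\<close>.\<close>

lemma arc_Int_Suc:
  assumes "Suc m < n" "x \<in> arc n E i (Suc m)" "x \<in> arc n E (Suc i) (Suc m)"
  shows "x \<in> arc n E (Suc i) m"
  unfolding arc_def
proof (intro CollectI conjI allI impI)
  show "x \<in> cycles n E" using assms arc_subset_cycles by blast
  fix j assume j: "j < n"
  have *: "fst x ((Suc i + j) mod n) = 0 \<and> snd x ((Suc i + j) mod n) = 0" if "m \<le> j"
  proof (cases "Suc j < n")
    case True
    then have "fst x ((i + Suc j) mod n) = 0 \<and> snd x ((i + Suc j) mod n) = 0"
      using assms(2) that unfolding arc_def by blast
    then show ?thesis by simp
  next
    \<comment> \<open>Here \<open>j = n - 1\<close>, so the index is \<open>i\<close>. The first arc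
      leaves the label at \<open>i\<close> free; the second one forces it to vanish since
      \<open>Suc m \<le> n - 1\<close>.\<close>
    case False
    then show ?thesis using assms(1,3) j unfolding arc_def by auto
  qed
  then show "snd x ((Suc i + j) mod n) = 0" if "m \<le> j" using that by blast
  show "fst x ((Suc i + j) mod n) = 0" if "j = 0 \<or> m \<le> j"
    using * that assms(3) j unfolding arc_def by blast
qed

text \<open>For \<open>m = n\<close> only the vertex condition at offset 0 is left. The longest arcs
  thus encode exactly the subspaces that an isomorphism of trellises has to respect.\<close>

lemma arc_full:
  assumes "i < n" shows "arc n E i n = {x \<in> cycles n E. fst x i = 0}"
  using assms unfolding arc_def by auto

text \<open>The map from offsets \<open>j < n\<close> to \<open>(i + j) mod n\<close> is a bijection
  onto the indices, and it turns the conditions on intervals into conditions on offsets.\<close>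

lemma span_cycles_Span:
  assumes "i < n" "l < n"
  shows "span_cycles n E (Span i l) = arc n E i (Suc l)"
proof -
  have "has_span n (Span i l) x \<longleftrightarrow> (\<forall>j<n. (j = 0 \<or> Suc l \<le> j \<longrightarrow> fst x ((i + j) mod n) = 0)
      \<and> (Suc l \<le> j \<longrightarrow> snd x ((i + j) mod n) = 0))" (is "?A \<longleftrightarrow> ?B") for x :: "(nat \<Rightarrow> 'a) \<times> (nat \<Rightarrow> 'b)"
  proof -
    have c: "(i + j) mod n \<in> cinterval n i l \<longleftrightarrow> j \<le> l" if "j < n" for j
    proof
      assume "(i + j) mod n \<in> cinterval n i l"
      then obtain j' where j': "j' \<le> l" "(i + j) mod n = (i + j') mod n"
        unfolding cinterval_def by blast
      then show "j \<le> l" using offset_inject[of i n j j'] assms that by simp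
    qed (auto simp: cinterval_def)
    have z: "(i + j) mod n = i \<longleftrightarrow> j = 0" if "j < n" for j
      using offset_inject[of i n j 0] that assms by auto
    have o: "(i + j) mod n \<in> ointerval n i l \<longleftrightarrow> j \<le> l \<and> j \<noteq> 0" if "j < n" for j
      unfolding ointerval_def using c z that by simp
    have all: "(\<forall>k<n. P k) \<longleftrightarrow> (\<forall>j<n. P ((i + j) mod n))" for P
    proof (intro iffI allI impI)
      show "P ((i + j) mod n)" if "\<forall>k<n. P k" for j
        using that assms(1) by simp
      show "P k" if "\<forall>j<n. P ((i + j) mod n)" "k < n" for k
        using index_offset[OF assms(1) \<open>k < n\<close>] that(1) by metis
    qed
    have "?A \<longleftrightarrow> (\<forall>k<n. (fst x k \<noteq> 0 \<longrightarrow> k \<in> ointerval n i l) \<and> (snd x k \<noteq> 0 \<longrightarrow> k \<in> cinterval n i l))"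
      unfolding has_span_def by auto
    also have "\<dots> \<longleftrightarrow> ?B"
      unfolding all[of "\<lambda>k. (fst x k \<noteq> 0 \<longrightarrow> k \<in> ointerval n i l) \<and> (snd x k \<noteq> 0 \<longrightarrow> k \<in> cinterval n i l)"]
      using c o by (metis not_less_eq_eq)
    finally show ?thesis .
  qed
  then show ?thesis unfolding span_cycles_def arc_def by blast
qed

section \<open>The cycle space of a single linear trellis\<close>

locale trellis =
  fixes sc :: "'f::{field,finite} \<Rightarrow> 'v::ab_group_add \<Rightarrow> 'v"
    and n :: nat and V :: "nat \<Rightarrow> 'v set" and E :: "nat \<Rightarrow> ('v \<times> 'f \<times> 'v) set"
  assumes linear_trellis: "linear_trellis sc n V E"
begin

lemma n_pos: "0 < n"
  using linear_trellis unfolding linear_trellis_def by simp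

sublocale vector_space sc
  using linear_trellis unfolding linear_trellis_def by simp

sublocale cyc: vector_space "cyc_scale sc"
  by unfold_locales
    (auto simp: cyc_scale_def scale_right_distrib scale_left_distrib algebra_simps plus_fun_def)

lemma nxt_less: "nxt n i < n"
  using n_pos by (simp add: nxt_def)

lemma finite_V: "i < n \<Longrightarrow> finite (V i)"
  and subspace_V: "i < n \<Longrightarrow> subspace (V i)"
  and edge_vertices: "i < n \<Longrightarrow> (v, a, w) \<in> E i \<Longrightarrow> v \<in> V i \<and> w \<in> V (nxt n i)"
  and edge_zero: "i < n \<Longrightarrow> (0, 0, 0) \<in> E i"
  and edge_add: "i < n \<Longrightarrow> (v, a, w) \<in> E i \<Longrightarrow> (v', a', w') \<in> E i \<Longrightarrow> (v + v', a + a', w + w') \<in> E i"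
  and edge_scale: "i < n \<Longrightarrow> (v, a, w) \<in> E i \<Longrightarrow> (sc c v, c * a, sc c w) \<in> E i"
  and edge_from: "i < n \<Longrightarrow> v \<in> V i \<Longrightarrow> \<exists>a w. (v, a, w) \<in> E i"
  using linear_trellis unfolding linear_trellis_def by blast+

lemma cycle_vertex: "x \<in> cycles n E \<Longrightarrow> i < n \<Longrightarrow> fst x i \<in> V i"
  unfolding cycles_def using edge_vertices by fastforce

lemma subspace_cycles: "cyc.subspace (cycles n E)"
proof (rule cyc.subspaceI)
  show "0 \<in> cycles n E"
    using edge_zero by (simp add: cycles_def zero_prod_def)
  show "x + y \<in> cycles n E" if "x \<in> cycles n E" "y \<in> cycles n E" for x y
    using that edge_add by (auto simp: cycles_def)
  show "cyc_scale sc c x \<in> cycles n E" if "x \<in> cycles n E" for c x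
    using that edge_scale by (auto simp: cycles_def cyc_scale_def)
qed

text \<open>Cycles are functions on all naturals; since they vanish from \<open>n\<close> on, only
  finitely many values are free.\<close>

lemma finite_cycles: "finite (cycles n E)"
proof -
  let ?F = "\<lambda>S. {f. \<forall>i. (i \<in> {..<n} \<longrightarrow> f i \<in> S) \<and> (i \<notin> {..<n} \<longrightarrow> f i = 0)}"
  have "finite (?F (\<Union>i<n. V i) \<times> ?F (UNIV :: 'f set))"
    by (intro finite_cartesian_product finite_set_of_finite_funs) (auto simp: finite_V)
  moreover have "cycles n E \<subseteq> ?F (\<Union>i<n. V i) \<times> ?F UNIV"
  proof
    fix x assume x: "x \<in> cycles n E"
    have "fst x i = 0" "snd x i = 0" if "\<not> i < n" for i
      using x that unfolding cycles_def by auto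
    then show "x \<in> ?F (\<Union>i<n. V i) \<times> ?F UNIV"
      using cycle_vertex[OF x] by (auto simp: mem_Times_iff)
  qed
  ultimately show ?thesis by (rule finite_subset[rotated])
qed

lemma subspace_arc: "cyc.subspace (arc n E i m)"
proof (rule cyc.subspaceI)
  show "0 \<in> arc n E i m"
    using cyc.subspace_0[OF subspace_cycles] by (simp add: arc_def)
  show "x + y \<in> arc n E i m" if "x \<in> arc n E i m" "y \<in> arc n E i m" for x y
    using that cyc.subspace_add[OF subspace_cycles] by (simp add: arc_def)
  show "cyc_scale sc c x \<in> arc n E i m" if "x \<in> arc n E i m" for c x
    using that cyc.subspace_scale[OF subspace_cycles] by (simp add: arc_def cyc_scale_def)
qed

lemma finite_arc: "finite (arc n E i m)"
  using arc_subset_cycles finite_cycles by (rule finite_subset)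

lemma arc_0:
  assumes "i < n" shows "arc n E i 0 = {0}"
proof -
  have "x = 0" if x: "x \<in> arc n E i 0" for x
  proof -
    have "fst x k = 0 \<and> snd x k = 0" if "k < n" for k
      using index_offset[OF assms that] x unfolding arc_def by blast
    then show ?thesis
      using cycle_eq_zero_iff x arc_subset_cycles by blast
  qed
  then show ?thesis using cyc.subspace_0[OF subspace_arc] by blast
qed

text \<open>Since consecutive partial sums of the \<open>d i\<close> agree at the vertex between them, they can be
  glued to a single cycle, and its differences with the partial sums are the \<open>e i\<close>.\<close>

lemma cycle_syzygy:
  assumes d: "\<And>i. i < n \<Longrightarrow> d i \<in> arc n E i n" and sum: "sum d {..<n} = 0"
  obtains e where "\<And>i. i < n \<Longrightarrow> e i \<in> arc n E (Suc i) (n - 1)"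
    and "\<And>i. i < n \<Longrightarrow> d (nxt n i) = e i - e (nxt n i)"
proof -
  define s where "s i = sum d {..i}" for i
  have s_cycle: "s i \<in> cycles n E" if "i < n" for i
    unfolding s_def
  proof (rule cyc.subspace_sum[OF subspace_cycles])
    show "d j \<in> cycles n E" if "j \<in> {..i}" for j
      using subsetD[OF arc_subset_cycles d] that \<open>i < n\<close> by simp
  qed
  have s_nxt: "s (nxt n i) = s i + d (nxt n i)" if "i < n" for i
  proof (cases "Suc i < n")
    case True
    then show ?thesis by (simp add: s_def nxt_def)
  next
    \<comment> \<open>Wrapping around: the last partial sum is the full sum, which is 0, and
      \<open>s 0\<close> is \<open>d 0\<close>.\<close>
    case False
    then have i: "Suc i = n" using that by simp
    then have "s i = 0" using sum by (simp add: s_def lessThan_Suc_atMost flip: i)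
    moreover have "nxt n i = 0" using i by (simp add: nxt_def)
    ultimately show ?thesis by (simp add: s_def)
  qed
  have "fst (d i) i = 0" if "i < n" for i
    using d[OF that] that by (simp add: arc_full)
  then have agree: "fst (s (nxt n i)) (nxt n i) = fst (s i) (nxt n i)" if "i < n" for i
    using s_nxt[OF that] nxt_less by simp
  \<comment> \<open>The glued cycle uses the edge of \<open>s i\<close> in section \<open>i\<close>.
    Consecutive edges fit because \<open>d (nxt n i)\<close> vanishes at its own starting
    vertex.\<close>
  define w where "w = (\<lambda>i. if i < n then fst (s i) i else 0, \<lambda>i. if i < n then snd (s i) i else 0)"
  have "w \<in> cycles n E"
  proof -
    have "(fst (s i) i, snd (s i) i, fst (s (nxt n i)) (nxt n i)) \<in> E i" if "i < n" for i
      using s_cycle[OF that] that unfolding agree[OF that] cycles_def by auto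
    then show ?thesis using nxt_less unfolding w_def cycles_def by simp
  qed
  show thesis
  proof (rule that[of "\<lambda>i. w - s i"])
    fix i assume i: "i < n"
    have "w - s i \<in> cycles n E"
      using cyc.subspace_diff[OF subspace_cycles \<open>w \<in> cycles n E\<close> s_cycle[OF i]] .
    moreover have "fst (w - s i) i = 0" "snd (w - s i) i = 0" "fst (w - s i) (nxt n i) = 0"
      using i nxt_less agree by (simp_all add: w_def)
    \<comment> \<open>The arc of length \<open>n - 1\<close> from \<open>Suc i\<close> constrains
      only offset 0, the vertex at \<open>nxt n i\<close>, and offset \<open>n - 1\<close>, the
      vertex and label at \<open>i\<close>.\<close>
    moreover have "(Suc i + j) mod n = i" if "j < n" "n - 1 \<le> j" for j
    proof -
      have "Suc i + j = i + n" using that by simp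
      then show ?thesis using i by (metis mod_add_self2 mod_less)
    qed
    ultimately show "w - s i \<in> arc n E (Suc i) (n - 1)"
      unfolding arc_def nxt_def by auto
    show "d (nxt n i) = w - s i - (w - s (nxt n i))"
      using s_nxt[OF i] by simp
  qed
qed

text \<open>With the \<open>e i\<close> of \<open>cycle_syzygy\<close> and
  \<open>nxt n j = i\<close>, the splitting is \<open>d i = e j - e i\<close>. What has to be shown
  is that the \<open>e i\<close>, at first only known to lie in arcs of length \<open>n - 1\<close>,
  lie in arcs of length \<open>m\<close>.\<close>

lemma arc_syzygy:
  assumes m: "m < n" and d: "\<And>i. i < n \<Longrightarrow> d i \<in> arc n E i (Suc m)"
    and sum: "sum d {..<n} = 0" and i: "i < n"
  obtains p q where "p \<in> arc n E i m" "q \<in> arc n E (Suc i) m" "d i = p + q"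
proof -
  have "d i \<in> arc n E i n" if "i < n" for i
    using d[OF that] arc_mono[of "Suc m" n n E i] m by auto
  then obtain e where e: "\<And>i. i < n \<Longrightarrow> e i \<in> arc n E (Suc i) (n - 1)"
    and de: "\<And>i. i < n \<Longrightarrow> d (nxt n i) = e i - e (nxt n i)"
    using cycle_syzygy sum by metis
  have "m \<le> n - 1" using m by simp
  \<comment> \<open>Descending induction on the length, for all indices at once. From
    \<open>e i = e j - d i\<close> the cycle \<open>e i\<close> lies in the arc of length
    \<open>Suc r\<close> starting at \<open>i\<close>, and by hypothesis also in the one starting at
    \<open>Suc i\<close>; \<open>arc_Int_Suc\<close> shortens the latter by one.\<close>
  then have em: "\<forall>i<n. e i \<in> arc n E (Suc i) m"
  proof (induction rule: inc_induct)
    case base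
    then show ?case using e by blast
  next
    case (step r)
    show ?case
    proof (intro allI impI)
      fix i assume i: "i < n"
      obtain j where j: "j < n" "nxt n j = i" using nxt_surj[OF i] .
      have "e j \<in> arc n E i (Suc r)"
        using step.IH j arc_nxt[of n E j] by auto
      moreover have "d i \<in> arc n E i (Suc r)"
        using d[OF i] arc_mono[of "Suc m" "Suc r" n E i] step.hyps by auto
      ultimately have "e j - d i \<in> arc n E i (Suc r)"
        by (rule cyc.subspace_diff[OF subspace_arc])
      then have "e i \<in> arc n E i (Suc r)" using de[OF j(1)] j(2) by simp
      then show "e i \<in> arc n E (Suc i) r"
        using arc_Int_Suc[of r n "e i" E i] step i by simp
    qed
  qed
  obtain j where j: "j < n" "nxt n j = i" using nxt_surj[OF i] .
  show thesis
  proof (rule that[of "e j" "- e i"])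
    show "e j \<in> arc n E i m" using em j arc_nxt[of n E j] by auto
    show "- e i \<in> arc n E (Suc i) m" using em i cyc.subspace_neg[OF subspace_arc] by blast
    show "d i = e j + - e i" using de[OF j(1)] j(2) by simp
  qed
qed

lemma subspace_span_cycles:
  assumes "is_span n s" shows "cyc.subspace (span_cycles n E s)"
proof (cases s)
  case SpanEmpty
  then have "span_cycles n E s = {0}"
    using cyc.subspace_0[OF subspace_cycles]
    by (auto simp: span_cycles_def has_span_def zero_prod_def)
  then show ?thesis by (simp only: cyc.subspace_single_0)
next
  case SpanAll
  then have "span_cycles n E s = cycles n E"
    by (auto simp: span_cycles_def has_span_def)
  then show ?thesis by (simp add: subspace_cycles)
next
  case (Span a l)
  then have "span_cycles n E s = arc n E a (Suc l)"
    using assms n_pos by (auto simp: is_span_def intro!: span_cycles_Span)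
  then show ?thesis by (simp add: subspace_arc)
qed

lemma finite_span_cycles: "finite (span_cycles n E s)"
  unfolding span_cycles_def using finite_cycles by simp

text \<open>Trimness supplies an edge leaving \<open>v\<close>, and reducedness puts that edge on a
  cycle.\<close>

lemma vertex_on_cycle:
  assumes "reduced n E" "i < n" "v \<in> V i"
  obtains x where "x \<in> cycles n E" "fst x i = v"
proof -
  obtain a w where "(v, a, w) \<in> E i" using edge_from assms by blast
  then show thesis using assms that unfolding reduced_def by force
qed

end

section \<open>Isomorphisms from matching cycle spaces\<close>

locale trellis_pair = T: trellis sc n V E + T': trellis sc' n V' E'
  for sc :: "'f::{field,finite} \<Rightarrow> 'v::ab_group_add \<Rightarrow> 'v"
    and sc' :: "'f \<Rightarrow> 'w::ab_group_add \<Rightarrow> 'w"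
    and n V E V' E'
begin

sublocale labelled_spaces "cyc_scale sc" "cyc_scale sc'" "\<lambda>c a i. c * a i" snd snd
  by unfold_locales (simp_all add: cyc_scale_def)

text \<open>Induction on \<open>m\<close>. One \<open>G\<close> has to match all arcs of length
  \<open>m\<close> simultaneously, because \<open>arc_syzygy\<close> splits a member of a vanishing
  sum into pieces from arcs with two different starting points. Adding the partners of the two
  pieces gives the partner required by \<open>partial_iso_matching\<close>.\<close>

lemma matching_arcs:
  assumes card: "\<And>i m. i < n \<Longrightarrow> m \<le> n \<Longrightarrow> card (arc n E i m) = card (arc n E' i m)"
    and L: "\<And>i m. i < n \<Longrightarrow> m \<le> n \<Longrightarrow> snd ` arc n E i m = snd ` arc n E' i m"
    and "m \<le> n"
  shows "\<exists>G. partial_iso G \<and> (\<forall>i<n. matches G (arc n E i m) (arc n E' i m))"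
  using \<open>m \<le> n\<close>
proof (induction m)
  case 0
  then show ?case
    using partial_iso_zero by (auto simp: T.arc_0 T'.arc_0 matches_def zero_prod_def)
next
  case (Suc m)
  then have m: "m < n" by simp
  from Suc obtain G where G: "partial_iso G" and match: "\<And>i. i < n \<Longrightarrow> matches G (arc n E i m) (arc n E' i m)"
    by auto
  have match_Suc: "matches G (arc n E (Suc i) m) (arc n E' (Suc i) m)" for i
    using match[OF T.nxt_less, of i] by (simp add: arc_nxt)
  have up: "arc n F i m \<subseteq> arc n F i (Suc m)" "arc n F (Suc i) m \<subseteq> arc n F i (Suc m)"
    for F :: "nat \<Rightarrow> ('b::zero \<times> 'c::zero \<times> 'b) set" and i
    by (simp_all add: arc_Suc_subset[OF m] arc_mono)
  obtain G' where "partial_iso G'" "\<And>i. i \<in> {..<n} \<Longrightarrow> matches G' (arc n E i (Suc m)) (arc n E' i (Suc m))"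
  proof (rule partial_iso_matching[OF finite_lessThan G])
    fix x i assume "\<And>i. i \<in> {..<n} \<Longrightarrow> x i \<in> arc n E i (Suc m)" "sum x {..<n} = 0" and i: "i \<in> {..<n}"
    then obtain p q where pq: "p \<in> arc n E i m" "q \<in> arc n E (Suc i) m" "x i = p + q"
      using T.arc_syzygy[OF m, of x i] by (metis lessThan_iff)
    obtain p' where p': "p' \<in> arc n E' i m" "(p, p') \<in> G"
      using matches_obtain1[OF match pq(1)] i by auto
    obtain q' where q': "q' \<in> arc n E' (Suc i) m" "(q, q') \<in> G"
      using matches_obtain1[OF match_Suc pq(2)] .
    have "p' + q' \<in> arc n E' i (Suc m)"
      using p' q' up T'.cyc.subspace_add[OF T'.subspace_arc] by blast
    then show "\<exists>y\<in>arc n E' i (Suc m). (x i, y) \<in> G"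
      using partial_iso_add[OF G p'(2) q'(2)] pq by auto
  next
    fix y i assume "\<And>i. i \<in> {..<n} \<Longrightarrow> y i \<in> arc n E' i (Suc m)" "sum y {..<n} = 0" and i: "i \<in> {..<n}"
    then obtain p q where pq: "p \<in> arc n E' i m" "q \<in> arc n E' (Suc i) m" "y i = p + q"
      using T'.arc_syzygy[OF m, of y i] by (metis lessThan_iff)
    obtain p' where p': "p' \<in> arc n E i m" "(p', p) \<in> G"
      using matches_obtain2[OF match pq(1)] i by auto
    obtain q' where q': "q' \<in> arc n E (Suc i) m" "(q', q) \<in> G"
      using matches_obtain2[OF match_Suc pq(2)] .
    have "p' + q' \<in> arc n E i (Suc m)"
      using p' q' up T.cyc.subspace_add[OF T.subspace_arc] by blast
    then show "\<exists>x\<in>arc n E i (Suc m). (x, y i) \<in> G"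
      using partial_iso_add[OF G p'(2) q'(2)] pq by auto
  qed (use Suc.prems card L T.finite_arc T.subspace_arc T'.finite_arc T'.subspace_arc in auto)
  then show ?case by auto
qed

text \<open>The arcs of length \<open>n\<close> are matched first; the data for
  \<open>SpanAll\<close> then allow an extension to the whole cycle spaces. As the matching of these
  arcs persists, partners vanish at the same vertices.\<close>

lemma matching_cycles:
  assumes card: "\<And>s. is_span n s \<Longrightarrow> card (span_cycles n E s) = card (span_cycles n E' s)"
    and code: "\<And>s. is_span n s \<Longrightarrow> span_code n E s = span_code n E' s"
  obtains G where "partial_iso G" "fst ` G = cycles n E" "snd ` G = cycles n E'"
    "\<And>i x y. i < n \<Longrightarrow> (x, y) \<in> G \<Longrightarrow> fst x i = 0 \<longleftrightarrow> fst y i = 0"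
proof -
  have "card (arc n E i m) = card (arc n E' i m) \<and> snd ` arc n E i m = snd ` arc n E' i m"
    if "i < n" "m \<le> n" for i m
  proof (cases m)
    case 0
    then show ?thesis using \<open>i < n\<close> by (simp add: T.arc_0 T'.arc_0)
  next
    case (Suc l)
    then have "is_span n (Span i l)" "l < n" using that by (auto simp: is_span_def)
    then show ?thesis
      using card[of "Span i l"] code[of "Span i l"] that
      by (simp add: Suc span_code_def span_cycles_Span)
  qed
  then obtain G where G: "partial_iso G"
    and match: "\<And>i. i < n \<Longrightarrow> matches G (arc n E i n) (arc n E' i n)"
    using matching_arcs[of n] by auto
  \<comment> \<open>\<open>G\<close> is not known to stay inside the cycle spaces, so it is cut down
    before being extended.\<close>
  let ?G = "G \<inter> cycles n E \<times> cycles n E'"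
  have all: "span_cycles n F SpanAll = cycles n F" for F :: "nat \<Rightarrow> ('b::zero \<times> 'c::zero \<times> 'b) set"
    by (auto simp: span_cycles_def has_span_def)
  have "card (cycles n E) = card (cycles n E')" "snd ` cycles n E = snd ` cycles n E'"
    using card[of SpanAll] code[of SpanAll] by (simp_all add: all is_span_def span_code_def)
  then obtain H where H: "partial_iso H" "?G \<subseteq> H" "fst ` H = cycles n E" "snd ` H = cycles n E'"
    using partial_iso_extends[OF partial_iso_Int[OF G T.subspace_cycles T'.subspace_cycles] Int_lower2
        T.finite_cycles T.subspace_cycles T'.finite_cycles T'.subspace_cycles] by metis
  have matchH: "matches H (arc n E i n) (arc n E' i n)" if "i < n" for i
  proof (rule matches_mono[OF match[OF that]])
    show "G \<inter> arc n E i n \<times> arc n E' i n \<subseteq> H"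
      using H(2) arc_subset_cycles[of n E i n] arc_subset_cycles[of n E' i n] by blast
  qed
  show thesis
  proof (rule that[OF H(1,3,4)])
    fix i x y assume i: "i < n" and xy: "(x, y) \<in> H"
    have "x \<in> cycles n E" "y \<in> cycles n E'" using xy H(3,4) by force+
    then show "fst x i = 0 \<longleftrightarrow> fst y i = 0"
      using matches_iff[OF H(1) matchH[OF i] xy] i by (simp add: arc_full)
  qed
qed

text \<open>The vertex map \<open>f i\<close> sends the vertex of a cycle at \<open>i\<close> to the
  vertex of its partner. Reducedness ensures that all vertices and edges are reached by cycles, so
  linearity and the edge condition are inherited from \<open>G\<close>.\<close>

lemma lin_isomorphic_if_matching:
  assumes red: "reduced n E" "reduced n E'"
    and G: "partial_iso G" "fst ` G = cycles n E" "snd ` G = cycles n E'"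
    and zero: "\<And>i x y. i < n \<Longrightarrow> (x, y) \<in> G \<Longrightarrow> fst x i = 0 \<longleftrightarrow> fst y i = 0"
  shows "lin_isomorphic sc sc' n V E V' E'"
proof -
  define f where "f i v = (SOME w. \<exists>x y. (x, y) \<in> G \<and> fst x i = v \<and> fst y i = w)" for i v
  \<comment> \<open>Applying \<open>zero\<close> to differences yields both that \<open>f i\<close>
    is independent of the chosen cycle and that it is injective.\<close>
  have inj: "fst x i = fst x' i \<longleftrightarrow> fst y i = fst y' i"
    if "i < n" "(x, y) \<in> G" "(x', y') \<in> G" for i x y x' y'
    using zero[OF that(1) partial_iso_diff[OF G(1) that(2,3)]] by simp
  have f: "f i (fst x i) = fst y i" if "i < n" "(x, y) \<in> G" for i x y
    unfolding f_def
  proof (rule some_equality)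
    show "\<exists>x' y'. (x', y') \<in> G \<and> fst x' i = fst x i \<and> fst y' i = fst y i"
      using that by blast
    show "w = fst y i" if "\<exists>x' y'. (x', y') \<in> G \<and> fst x' i = fst x i \<and> fst y' i = w" for w
      using that inj[OF \<open>i < n\<close> \<open>(x, y) \<in> G\<close>] by metis
  qed
  have cyc: "x \<in> cycles n E" "y \<in> cycles n E'" if "(x, y) \<in> G" for x y
    using that G(2,3) by force+
  have V_G: "\<exists>x y. (x, y) \<in> G \<and> fst x i = v" if iv: "i < n" "v \<in> V i" for i v
  proof -
    obtain x where x: "x \<in> cycles n E" "fst x i = v"
      using T.vertex_on_cycle[OF red(1) iv] .
    then obtain y where "(x, y) \<in> G" unfolding G(2)[symmetric] by auto
    then show ?thesis using x by blast
  qed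
  have V'_G: "\<exists>x y. (x, y) \<in> G \<and> fst y i = v" if iv: "i < n" "v \<in> V' i" for i v
  proof -
    obtain y where y: "y \<in> cycles n E'" "fst y i = v"
      using T'.vertex_on_cycle[OF red(2) iv] .
    then obtain x where "(x, y) \<in> G" unfolding G(3)[symmetric] by auto
    then show ?thesis using y by blast
  qed
  have f_inj: "v = v'" if "i < n" "v \<in> V i" "v' \<in> V i" "f i v = f i v'" for i v v'
    using V_G[OF that(1,2)] V_G[OF that(1,3)] f[OF that(1)] inj[OF that(1)] that(4) by metis
  have "lin_iso sc sc' n V E V' E' f"
    unfolding lin_iso_def
  proof (intro allI impI conjI ballI)
    fix i assume i: "i < n"
    show "bij_betw (f i) (V i) (V' i)"
    proof (rule bij_betw_imageI)
      show "inj_on (f i) (V i)" using f_inj[OF i] by (rule inj_onI)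
      show "f i ` V i = V' i"
      proof (intro equalityI subsetI)
        fix w assume "w \<in> f i ` V i"
        then obtain v where v: "v \<in> V i" "w = f i v" by blast
        obtain x y where "(x, y) \<in> G" "fst x i = v" using V_G[OF i v(1)] by blast
        then show "w \<in> V' i"
          using f[OF i, of x y] T'.cycle_vertex[OF cyc(2) i, of x y] v by simp
      next
        fix w assume w: "w \<in> V' i"
        obtain x y where "(x, y) \<in> G" "fst y i = w" using V'_G[OF i w] by blast
        then show "w \<in> f i ` V i"
          using f[OF i, of x y] T.cycle_vertex[OF cyc(1) i, of x y] by force
      qed
    qed
    show "f i (u + v) = f i u + f i v" if uv: "u \<in> V i" "v \<in> V i" for u v
    proof -
      obtain x y x' y' where G': "(x, y) \<in> G" "fst x i = u" "(x', y') \<in> G" "fst x' i = v"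
        using V_G[OF i uv(1)] V_G[OF i uv(2)] by blast
      then show ?thesis
        using f[OF i partial_iso_add[OF G(1) G'(1,3)]] f[OF i G'(1)] f[OF i G'(3)] by simp
    qed
    show "f i (sc c v) = sc' c (f i v)" if v: "v \<in> V i" for c v
    proof -
      obtain x y where G': "(x, y) \<in> G" "fst x i = v"
        using V_G[OF i v] by blast
      then show ?thesis
        using f[OF i partial_iso_scale[OF G(1) G'(1), of c]] f[OF i G'(1)]
        by (simp add: cyc_scale_def)
    qed
    show "(v, a, w) \<in> E i \<longleftrightarrow> (f i v, a, f (nxt n i) w) \<in> E' i"
      if v: "v \<in> V i" and w: "w \<in> V (nxt n i)" for v w a
    proof
      assume "(v, a, w) \<in> E i"
      then obtain x where x: "x \<in> fst ` G" and e: "(v, a, w) = (fst x i, snd x i, fst x (nxt n i))"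
        using red(1) i G(2) unfolding reduced_def by force
      from x obtain y where xy: "(x, y) \<in> G" by force
      have "(fst y i, snd y i, fst y (nxt n i)) \<in> E' i"
        using cyc(2)[OF xy] i by (auto simp: cycles_def)
      then show "(f i v, a, f (nxt n i) w) \<in> E' i"
        using f[OF i xy] f[OF T.nxt_less xy] e partial_iso_label[OF G(1) xy] by simp
    next
      \<comment> \<open>A cycle of the second trellis through the image edge has a partner in the
        first; injectivity of the vertex maps identifies its vertices as \<open>v\<close> and
        \<open>w\<close>.\<close>
      assume "(f i v, a, f (nxt n i) w) \<in> E' i"
      then obtain y where y: "y \<in> snd ` G"
        and e: "(f i v, a, f (nxt n i) w) = (fst y i, snd y i, fst y (nxt n i))"
        using red(2) i G(3) unfolding reduced_def by force
      from y obtain x where xy: "(x, y) \<in> G" by force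
      have "fst x i = v"
        using f_inj[OF i T.cycle_vertex[OF cyc(1)[OF xy] i] v] f[OF i xy] e by simp
      moreover have "fst x (nxt n i) = w"
        using f_inj[OF T.nxt_less T.cycle_vertex[OF cyc(1)[OF xy] T.nxt_less] w]
          f[OF T.nxt_less xy] e by simp
      moreover have "(fst x i, snd x i, fst x (nxt n i)) \<in> E i"
        using cyc(1)[OF xy] i by (auto simp: cycles_def)
      ultimately show "(v, a, w) \<in> E i"
        using e partial_iso_label[OF G(1) xy] by simp
    qed
  qed
  then show ?thesis unfolding lin_isomorphic_def by blast
qed

section \<open>Invariance of span spaces and codes under isomorphism\<close>

text \<open>The map \<open>\<phi>\<close> acts vertexwise by \<open>f\<close> and keeps the labels.
  Since each \<open>f i\<close> maps only 0 to 0, supports and hence spans are preserved. The value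
  0 from \<open>n\<close> on respects the convention for cycles.\<close>

lemma lin_iso_span_cycles:
  assumes f: "lin_iso sc sc' n V E V' E' f"
  defines "\<phi> \<equiv> \<lambda>x :: (nat \<Rightarrow> 'v) \<times> (nat \<Rightarrow> 'f). (\<lambda>i. if i < n then f i (fst x i) else 0, snd x)"
  shows "bij_betw \<phi> (span_cycles n E s) (span_cycles n E' s)"
proof -
  have bij: "bij_betw (f i) (V i) (V' i)"
    and add: "\<And>x y. x \<in> V i \<Longrightarrow> y \<in> V i \<Longrightarrow> f i (x + y) = f i x + f i y"
    and edge: "\<And>v w a. v \<in> V i \<Longrightarrow> w \<in> V (nxt n i) \<Longrightarrow>
      (v, a, w) \<in> E i \<longleftrightarrow> (f i v, a, f (nxt n i) w) \<in> E' i"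
    if "i < n" for i
    using f that unfolding lin_iso_def by blast+
  have f_zero: "f i v = 0 \<longleftrightarrow> v = 0" if i: "i < n" and v: "v \<in> V i" for i v
  proof -
    have V0: "0 \<in> V i" using T.subspace_0[OF T.subspace_V[OF i]] .
    then have "f i 0 = 0" using add[OF i V0 V0] by simp
    then show ?thesis using bij_betw_imp_inj_on[OF bij[OF i]] V0 v by (metis inj_onD)
  qed
  have zero_above: "fst x i = 0 \<and> snd x i = 0"
    if "x \<in> cycles n F" "\<not> i < n" for x i and F :: "nat \<Rightarrow> ('b::zero \<times> 'c::zero \<times> 'b) set"
    using that unfolding cycles_def by auto
  \<comment> \<open>An equivalence for arbitrary families of vertices, so that it both maps cycles
    forward and certifies the preimage built below as a cycle.\<close>
  have \<phi>_edge: "\<phi> x \<in> cycles n E' \<longleftrightarrow> x \<in> cycles n E"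
    if x: "\<And>i. i < n \<Longrightarrow> fst x i \<in> V i" "\<And>i. \<not> i < n \<Longrightarrow> fst x i = 0" for x
    using edge[OF _ x(1) x(1)[OF T.nxt_less]] T.nxt_less x(2)
    unfolding \<phi>_def cycles_def by (auto simp: not_less)
  have \<phi>_span: "has_span n s (\<phi> x) \<longleftrightarrow> has_span n s x" if x: "x \<in> cycles n E" for x
  proof -
    have nz: "fst (\<phi> x) i = 0 \<longleftrightarrow> fst x i = 0" for i
      using f_zero[OF _ T.cycle_vertex[OF x]] zero_above[OF x] by (auto simp: \<phi>_def)
    moreover have snd: "snd (\<phi> x) = snd x" by (simp add: \<phi>_def)
    moreover have "\<phi> x = (0, 0) \<longleftrightarrow> x = (0, 0)"
      using nz snd by (simp add: prod_eq_iff fun_eq_iff)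
    ultimately show ?thesis unfolding has_span_def by (cases s) simp_all
  qed
  have "inj_on \<phi> (cycles n E)"
  proof (rule inj_onI)
    fix x y assume x: "x \<in> cycles n E" and y: "y \<in> cycles n E" and eq: "\<phi> x = \<phi> y"
    have "fst x i = fst y i" for i
    proof (cases "i < n")
      case True
      then have "f i (fst x i) = f i (fst y i)"
        using eq by (auto simp: \<phi>_def fun_eq_iff split: if_splits)
      then show ?thesis
        using bij_betw_imp_inj_on[OF bij[OF True]] T.cycle_vertex[OF x True] T.cycle_vertex[OF y True]
        by (metis inj_onD)
    qed (use zero_above[OF x] zero_above[OF y] in simp)
    then show "x = y" using eq by (auto simp: \<phi>_def prod_eq_iff)
  qed
  then have "inj_on \<phi> (span_cycles n E s)"
    by (rule inj_on_subset) (auto simp: span_cycles_def)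
  moreover have "\<phi> ` span_cycles n E s = span_cycles n E' s"
  proof (intro equalityI subsetI)
    fix y assume "y \<in> \<phi> ` span_cycles n E s"
    then obtain x where x: "x \<in> cycles n E" "has_span n s x" "y = \<phi> x"
      by (auto simp: span_cycles_def)
    then have "\<phi> x \<in> cycles n E'"
      using \<phi>_edge[of x] T.cycle_vertex[OF x(1)] zero_above[OF x(1)] by blast
    then show "y \<in> span_cycles n E' s"
      using x \<phi>_span by (simp add: span_cycles_def)
  next
    fix y assume y: "y \<in> span_cycles n E' s"
    then have yc: "y \<in> cycles n E'" and ys: "has_span n s y" by (simp_all add: span_cycles_def)
    define x where "x = (\<lambda>i. if i < n then inv_into (V i) (f i) (fst y i) else 0, snd y)"
    have inv: "inv_into (V i) (f i) (fst y i) \<in> V i \<and> f i (inv_into (V i) (f i) (fst y i)) = fst y i"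
      if "i < n" for i
      using bij[OF that] T'.cycle_vertex[OF yc that]
      by (simp add: bij_betw_imp_surj_on f_inv_into_f inv_into_into)
    have \<phi>x: "\<phi> x = y"
      using inv zero_above[OF yc] by (auto simp: \<phi>_def x_def prod_eq_iff fun_eq_iff)
    moreover have xc: "x \<in> cycles n E"
      using \<phi>_edge[of x] inv yc \<phi>x by (simp add: x_def)
    ultimately show "y \<in> \<phi> ` span_cycles n E s"
      using \<phi>_span[OF xc] ys by (force simp: span_cycles_def)
  qed
  ultimately show ?thesis by (rule bij_betw_imageI)
qed

lemma lin_isomorphic_invariants:
  assumes "lin_isomorphic sc sc' n V E V' E'"
  shows "card (span_cycles n E s) = card (span_cycles n E' s)" "span_code n E s = span_code n E' s"
proof -
  obtain f where f: "lin_iso sc sc' n V E V' E' f"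
    using assms unfolding lin_isomorphic_def by blast
  note bij = lin_iso_span_cycles[OF f, of s]
  show "card (span_cycles n E s) = card (span_cycles n E' s)"
    using bij by (rule bij_betw_same_card)
  show "span_code n E s = span_code n E' s"
    unfolding span_code_def bij_betw_imp_surj_on[OF bij, symmetric] by (simp add: image_image)
qed

section \<open>The characterization, first by cardinalities and then by dimensions\<close>

lemma lin_isomorphic_iff_card:
  assumes "reduced n E" "reduced n E'"
  shows "lin_isomorphic sc sc' n V E V' E' \<longleftrightarrow>
    (\<forall>s. is_span n s \<longrightarrow> card (span_cycles n E s) = card (span_cycles n E' s) \<and>
       span_code n E s = span_code n E' s)" (is "_ \<longleftrightarrow> ?R")
proof
  assume ?R
  then obtain G where "partial_iso G" "fst ` G = cycles n E" "snd ` G = cycles n E'"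
    "\<And>i x y. i < n \<Longrightarrow> (x, y) \<in> G \<Longrightarrow> fst x i = 0 \<longleftrightarrow> fst y i = 0"
    using matching_cycles by metis
  then show "lin_isomorphic sc sc' n V E V' E'"
    by (rule lin_isomorphic_if_matching[OF assms])
qed (use lin_isomorphic_invariants in blast)

lemma dim_span_cycles_eq_iff:
  "is_span n s \<Longrightarrow>
    vector_space.dim (cyc_scale sc) (span_cycles n E s)
      = vector_space.dim (cyc_scale sc') (span_cycles n E' s) \<longleftrightarrow>
    card (span_cycles n E s) = card (span_cycles n E' s)"
  by (intro dim_eq_iff_card_eq T.finite_span_cycles T'.finite_span_cycles
      T.subspace_span_cycles T'.subspace_span_cycles
      T.cyc.vector_space_axioms T'.cyc.vector_space_axioms)

end

text \<open>For one-to-one trellises equal codes already force equal cardinalities of the span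
  spaces, which reduces the second claim to the first.\<close>

lemma card_span_code:
  assumes "one_to_one n E" shows "card (span_code n E s) = card (span_cycles n E s)"
proof -
  have "inj_on snd (span_cycles n E s)"
    using assms unfolding one_to_one_def by (rule inj_on_subset) (auto simp: span_cycles_def)
  then show ?thesis unfolding span_code_def by (rule card_image)
qed

theorem mainTheorem5:
  fixes sc :: "'f::{field,finite} \<Rightarrow> 'v::ab_group_add \<Rightarrow> 'v"
    and sc' :: "'f \<Rightarrow> 'w::ab_group_add \<Rightarrow> 'w"
    and n :: nat
    and V :: "nat \<Rightarrow> 'v set" and E :: "nat \<Rightarrow> ('v \<times> 'f \<times> 'v) set"
    and V' :: "nat \<Rightarrow> 'w set" and E' :: "nat \<Rightarrow> ('w \<times> 'f \<times> 'w) set"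
  assumes T: "linear_trellis sc n V E" and T': "linear_trellis sc' n V' E'"
    and red: "reduced n E" and red': "reduced n E'"
  shows "(lin_isomorphic sc sc' n V E V' E' \<longleftrightarrow>
           (\<forall>s. is_span n s \<longrightarrow>
              vector_space.dim (cyc_scale sc) (span_cycles n E s)
                = vector_space.dim (cyc_scale sc') (span_cycles n E' s) \<and>
              span_code n E s = span_code n E' s))
       \<and> (one_to_one n E \<and> one_to_one n E' \<longrightarrow>
           (lin_isomorphic sc sc' n V E V' E' \<longleftrightarrow>
              (\<forall>s. is_span n s \<longrightarrow> span_code n E s = span_code n E' s)))"
proof -
  interpret trellis_pair sc sc' n V E V' E'
    using T T' by (intro trellis_pair.intro trellis.intro)
  show ?thesis
    using lin_isomorphic_iff_card[OF red red'] dim_span_cycles_eq_iff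
      card_span_code[of n E] card_span_code[of n E'] by metis
qed

end
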